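(* Let $G\in\mathcal G$. Suppose there exists $\zeta\in(0,\tfrac12\pi)$ such that all but finitely many faces $F$ of $G$ are $\zeta$-acute. Then both $G$ and its matching graph $G_*$ have doubly infinite non-self-touching paths.
   Context: A plane graph is a graph embedded in $\mathbb R^2$ so that edges cross only at vertices. $\mathcal G$ denotes the class of countably infinite, locally finite, $2$-connected, simple plane graphs embedded in $\mathbb R^2$ with no vertex-accumulation points and no edge-accumulation points (a point $x$ is an edge-accumulation point if every neighbourhood of $x$ meets some edge not incident to $x$), and such that every face has finite Euclidean diameter. A face $F$ with $0\notin\overline F$ is $\zeta$-acute if there is a sector of $\mathbb R^2$ with vertex $0$ and angle $\zeta$ containing $F$. The matching graph $G_*$ is obtained from $G$ by adding, inside every non-triangular face $F$, an edge between every pair of non-adjacent vertices of the boundary cycle of $F$. A doubly infinite path $\pi=(\pi_i:i\in\mathbb Z)$ (distinct vertices, consecutive ones adjacent) is non-self-touching if $\pi_i\sim\pi_j$ holds if and only if $|i-j|=1$. *)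

theory Defs
  imports "HOL-Analysis.Analysis"
begin

record 'a graph =
  verts :: "'a set"
  edges :: "'a set set"

text \<open>The plane is \<^typ>\<open>complex\<close>. An edge is the set of its two endpoints, and \<open>curve G e\<close>
  is the arc by which \<open>e\<close> is drawn.\<close>

record plane_drawing = "complex graph" +
  curve :: "complex set \<Rightarrow> real \<Rightarrow> complex"

definition adj :: "('a, 'b) graph_scheme \<Rightarrow> 'a \<Rightarrow> 'a \<Rightarrow> bool" where
  "adj G u v \<longleftrightarrow> {u, v} \<in> edges G"

definition simple_graph :: "('a, 'b) graph_scheme \<Rightarrow> bool" where
  "simple_graph G \<longleftrightarrow>
     (\<forall>e \<in> edges G. \<exists>u v. u \<in> verts G \<and> v \<in> verts G \<and> u \<noteq> v \<and> e = {u, v})"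

definition locally_finite :: "('a, 'b) graph_scheme \<Rightarrow> bool" where
  "locally_finite G \<longleftrightarrow> (\<forall>v \<in> verts G. finite {e \<in> edges G. v \<in> e})"

definition connected_graph :: "('a, 'b) graph_scheme \<Rightarrow> bool" where
  "connected_graph G \<longleftrightarrow> verts G \<noteq> {} \<and> (\<forall>u \<in> verts G. \<forall>v \<in> verts G. (adj G)\<^sup>*\<^sup>* u v)"

definition delete_vertex :: "('a, 'b) graph_scheme \<Rightarrow> 'a \<Rightarrow> 'a graph" where
  "delete_vertex G v = \<lparr>verts = verts G - {v}, edges = {e \<in> edges G. v \<notin> e}\<rparr>"

definition two_connected :: "('a, 'b) graph_scheme \<Rightarrow> bool" where
  "two_connected G \<longleftrightarrow>
     (infinite (verts G) \<or> card (verts G) > 2) \<and>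
     connected_graph G \<and> (\<forall>v \<in> verts G. connected_graph (delete_vertex G v))"

definition plane_graph :: "plane_drawing \<Rightarrow> bool" where
  "plane_graph G \<longleftrightarrow>
     simple_graph G \<and>
     (\<forall>e \<in> edges G. arc (curve G e) \<and>
        {pathstart (curve G e), pathfinish (curve G e)} = e \<and>
        path_image (curve G e) \<inter> verts G = e) \<and>
     (\<forall>e \<in> edges G. \<forall>f \<in> edges G. e \<noteq> f \<longrightarrow>
        path_image (curve G e) \<inter> path_image (curve G f) \<subseteq> verts G)"

definition faces :: "plane_drawing \<Rightarrow> complex set set" where
  "faces G = components (- (verts G \<union> (\<Union>e \<in> edges G. path_image (curve G e))))"

definition vertex_accumulation_point :: "plane_drawing \<Rightarrow> complex \<Rightarrow> bool" where
  "vertex_accumulation_point G x \<longleftrightarrow> x islimpt verts G"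

text \<open>An edge counts as incident to every point of its closed arc; otherwise each interior
  point of an edge would be an accumulation point.\<close>

definition edge_accumulation_point :: "plane_drawing \<Rightarrow> complex \<Rightarrow> bool" where
  "edge_accumulation_point G x \<longleftrightarrow>
     (\<forall>U. open U \<and> x \<in> U \<longrightarrow>
        (\<exists>e \<in> edges G. x \<notin> path_image (curve G e) \<and> path_image (curve G e) \<inter> U \<noteq> {}))"

definition class_G :: "plane_drawing set" where
  "class_G = {G. plane_graph G \<and>
     infinite (verts G) \<and> countable (verts G) \<and>
     locally_finite G \<and> two_connected G \<and>
     (\<forall>x. \<not> vertex_accumulation_point G x) \<and>
     (\<forall>x. \<not> edge_accumulation_point G x) \<and>
     (\<forall>F \<in> faces G. bounded F)}"

definition sector :: "real \<Rightarrow> real \<Rightarrow> complex set" where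
  "sector \<alpha> \<zeta> = {of_real r * cis \<theta> | r \<theta>. 0 \<le> r \<and> \<alpha> \<le> \<theta> \<and> \<theta> \<le> \<alpha> + \<zeta>}"

definition acute :: "real \<Rightarrow> complex set \<Rightarrow> bool" where
  "acute \<zeta> F \<longleftrightarrow> 0 \<notin> closure F \<and> (\<exists>\<alpha>. F \<subseteq> sector \<alpha> \<zeta>)"

definition cycle_edges :: "'a list \<Rightarrow> 'a set set" where
  "cycle_edges c = {{c ! i, c ! (Suc i mod length c)} | i. i < length c}"

definition is_cycle :: "('a, 'b) graph_scheme \<Rightarrow> 'a list \<Rightarrow> bool" where
  "is_cycle G c \<longleftrightarrow> length c \<ge> 3 \<and> distinct c \<and> set c \<subseteq> verts G \<and> cycle_edges c \<subseteq> edges G"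

definition boundary_cycle :: "plane_drawing \<Rightarrow> complex set \<Rightarrow> complex list \<Rightarrow> bool" where
  "boundary_cycle G F c \<longleftrightarrow>
     is_cycle G c \<and> frontier F = (\<Union>e \<in> cycle_edges c. path_image (curve G e))"

text \<open>Every face of a graph in \<^const>\<open>class_G\<close> is bounded by a cycle, by 2-connectedness.
  Only the abstract graph structure is recorded; parallel diagonals arising from
  different faces are identified.\<close>

definition matching_graph :: "plane_drawing \<Rightarrow> complex graph" where
  "matching_graph G =
     \<lparr>verts = verts G,
      edges = edges G \<union>
        {{u, v} | u v. u \<noteq> v \<and> \<not> adj G u v \<and>
           (\<exists>F \<in> faces G. \<exists>c. boundary_cycle G F c \<and> length c \<noteq> 3 \<and> u \<in> set c \<and> v \<in> set c)}\<rparr>"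

definition doubly_infinite_path :: "('a, 'b) graph_scheme \<Rightarrow> (int \<Rightarrow> 'a) \<Rightarrow> bool" where
  "doubly_infinite_path G \<pi> \<longleftrightarrow>
     range \<pi> \<subseteq> verts G \<and> inj \<pi> \<and> (\<forall>i. adj G (\<pi> i) (\<pi> (i + 1)))"

definition non_self_touching :: "('a, 'b) graph_scheme \<Rightarrow> (int \<Rightarrow> 'a) \<Rightarrow> bool" where
  "non_self_touching G \<pi> \<longleftrightarrow> (\<forall>i j. adj G (\<pi> i) (\<pi> j) \<longleftrightarrow> \<bar>i - j\<bar> = 1)"

end

theory Submission
  imports Defs
begin

text \<open>Let \<open>X\<close> be the union of the edges. By acuteness any two points in the closure of a face outside a
  large disc have positive inner product. Hence no face meets both the far upper region \<open>P\<close>, where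
  \<open>\<bar>Re z\<bar> < Im z\<close>, and the far lower region \<open>Q = -P\<close>, so the closed set \<open>X - P - Q\<close> separates \<open>P\<close>
  from \<open>Q\<close>, and therefore one of its components \<open>C\<close> does. This \<open>C\<close> must reach infinity on the left and
  on the right, and its vertices induce a connected subgraph of \<open>G\<close>. No face outside the disc contains
  vertices of both the left and the right part of \<open>C\<close>, again because of the inner products, so not even
  the matching graph has an edge between the two parts. Shortest paths from far left to far right in
  the graph induced on the vertices of \<open>C\<close> are chordless and pass through the finite middle part; a
  compactness argument, valid because the matching graph is locally finite, yields the double ray.\<close>

section \<open>Compactness and chordless double rays in abstract graphs\<close>

text \<open>Diagonal argument: infinite index sets are nested so that the \<open>m\<close>-th one
  fixes coordinate \<open>m\<close>. Agreement of the limit with some \<open>g n\<close> up to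
  \<open>m\<close> suffices to transfer any property that looks at finitely many
  coordinates.\<close>

lemma finite_choice_limit:
  fixes g :: "nat \<Rightarrow> nat \<Rightarrow> 'a"
  assumes fin: "\<And>i. finite (B i)" and mem: "\<And>n i. i \<le> n \<Longrightarrow> g n i \<in> B i"
  shows "\<exists>f. \<forall>m. \<exists>n\<ge>m. \<forall>i\<le>m. g n i = f i"
proof -
  have refine: "\<exists>S'. (infinite S' \<and> (\<exists>x. \<forall>n\<in>S'. g n i = x)) \<and> S' \<subseteq> S" if "infinite S" for S i
  proof -
    \<comment> \<open>Only finitely many \<open>n < i\<close> are dropped; for these nothing places
      \<open>g n i\<close> in the finite set \<open>B i\<close>.\<close>
    define T where "T = {n \<in> S. i \<le> n}"
    have "S \<subseteq> T \<union> {..<i}"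
      by (auto simp: T_def)
    then have "infinite T"
      using that finite_subset by blast
    moreover have "finite ((\<lambda>n. g n i) ` T)"
      by (rule finite_subset[OF _ fin[of i]]) (auto simp: T_def mem)
    ultimately obtain n0 where "infinite {n \<in> T. g n i = g n0 i}"
      using pigeonhole_infinite[of T "\<lambda>n. g n i"] by blast
    then show ?thesis
      by (intro exI[of _ "{n \<in> T. g n i = g n0 i}"]) (auto simp: T_def)
  qed
  have "\<exists>S. \<forall>m. (infinite (S m) \<and> (\<exists>x. \<forall>n\<in>S m. g n m = x)) \<and> S (Suc m) \<subseteq> S m"
  proof (rule dependent_nat_choice)
    show "\<exists>S. infinite S \<and> (\<exists>x. \<forall>n\<in>S. g n 0 = x)"
      using refine[of UNIV 0] by auto
  next
    fix S m
    assume "infinite S \<and> (\<exists>x. \<forall>n\<in>S. g n m = x)"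
    then show "\<exists>S'. (infinite S' \<and> (\<exists>x. \<forall>n\<in>S'. g n (Suc m) = x)) \<and> S' \<subseteq> S"
      using refine[of S "Suc m"] by auto
  qed
  then obtain S where S: "\<And>m. infinite (S m)" "\<And>m. \<exists>x. \<forall>n\<in>S m. g n m = x"
    "\<And>m. S (Suc m) \<subseteq> S m"
    by blast
  obtain f where f: "\<And>m n. n \<in> S m \<Longrightarrow> g n m = f m"
    using S(2) by metis
  have "\<exists>n\<ge>m. \<forall>i\<le>m. g n i = f i" for m
  proof -
    obtain n where "n \<ge> m" "n \<in> S m"
      using S(1)[of m] by (meson infinite_nat_iff_unbounded_le)
    then show ?thesis
      using f lift_Suc_antimono_le[of S, OF S(3)] by blast
  qed
  then show ?thesis
    by blast
qed

text \<open>In a walk of least length, an \<open>R\<close>-step from \<open>f i\<close> to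
  \<open>f j\<close> with \<open>j > Suc i\<close> would give a shortcut.\<close>

lemma shortest_walk_chordless:
  fixes R :: "'a \<Rightarrow> 'a \<Rightarrow> bool"
  assumes "R\<^sup>*\<^sup>* a b"
  obtains f n where "f 0 = a" "f n = b" "\<And>i. i < n \<Longrightarrow> R (f i) (f (Suc i))"
    "\<And>i j. i < j \<Longrightarrow> j \<le> n \<Longrightarrow> R (f i) (f j) \<Longrightarrow> j = Suc i"
proof -
  define n where "n = (LEAST n. (R ^^ n) a b)"
  have "(R ^^ n) a b"
    unfolding n_def using assms by (metis LeastI_ex rtranclp_imp_relpowp)
  then obtain f where f: "f 0 = a" "f n = b" and step: "\<And>i. i < n \<Longrightarrow> R (f i) (f (Suc i))"
    by (auto simp: relpowp_fun_conv)
  have walk: "(R ^^ (j - i)) (f i) (f j)" if "i \<le> j" "j \<le> n" for i j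
    unfolding relpowp_fun_conv using that step
    by (intro exI[of _ "\<lambda>k. f (i + k)"]) auto
  have "j = Suc i" if "i < j" "j \<le> n" "R (f i) (f j)" for i j
  proof -
    have "(R ^^ Suc i) a (f j)"
      using walk[of 0 i] that f by (auto intro: relpowp_Suc_I)
    then have "(R ^^ (Suc i + (n - j))) a b"
      unfolding relpowp_add using walk[of j n] that f by (metis order_refl relcomppI)
    then have "n \<le> Suc i + (n - j)"
      unfolding n_def by (rule Least_le)
    then show ?thesis
      using that by linarith
  qed
  then show ?thesis
    using that f step by blast
qed

lemma finite_relpowp_image:
  fixes R :: "'a \<Rightarrow> 'a \<Rightarrow> bool"
  assumes "\<And>u. finite {v. R u v}"
  shows "finite {v. (R ^^ n) u v}"
proof (induction n)
  case (Suc n)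
  have "{v. (R ^^ Suc n) u v} = (\<Union>w\<in>{w. (R ^^ n) u w}. {v. R w v})"
    by (auto intro: relpowp_Suc_I elim: relpowp_Suc_E)
  then show ?case
    using Suc assms by simp
qed auto

lemma relpowp_symp:
  fixes R :: "'a \<Rightarrow> 'a \<Rightarrow> bool"
  assumes "\<And>u v. R u v \<Longrightarrow> R v u" and "(R ^^ n) u v"
  shows "(R ^^ n) v u"
  using assms(2)
proof (induction n arbitrary: v)
  case (Suc n)
  then show ?case
    by (metis assms(1) relpowp_Suc_E relpowp_Suc_I2)
qed auto

text \<open>A shortest walk from far in \<open>A\<close> to far in \<open>B\<close> has to visit the
  finite core. Recentred there, it is a chordless path with two long halves whose
  \<open>i\<close>-th vertices range over a finite set depending only on \<open>i\<close>, so a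
  limit exists. Injectivity is left out of the conclusion because the adjacency pattern forces
  it.\<close>

lemma induced_double_ray_exists:
  fixes E :: "'a \<Rightarrow> 'a \<Rightarrow> bool"
  assumes sym: "\<And>u v. E u v \<Longrightarrow> E v u" and irrefl: "\<And>u. \<not> E u u"
    and deg: "\<And>u. u \<in> V \<Longrightarrow> finite {v \<in> V. E u v}"
    and conn: "\<And>u v. u \<in> V \<Longrightarrow> v \<in> V \<Longrightarrow> (\<lambda>x y. E x y \<and> x \<in> V \<and> y \<in> V)\<^sup>*\<^sup>* u v"
    and sub: "A \<subseteq> V" "B \<subseteq> V" and core: "finite (V - (A \<union> B))" and disj: "A \<inter> B = {}"
    and inf: "infinite A" "infinite B"
    and no_edge: "\<And>a b. a \<in> A \<Longrightarrow> b \<in> B \<Longrightarrow> \<not> E a b"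
  shows "\<exists>\<pi>::int \<Rightarrow> 'a. range \<pi> \<subseteq> V \<and> (\<forall>i j. E (\<pi> i) (\<pi> j) \<longleftrightarrow> \<bar>i - j\<bar> = 1)"
proof -
  define R where "R = (\<lambda>x y. E x y \<and> x \<in> V \<and> y \<in> V)"
  define K where "K = V - (A \<union> B)"
  \<comment> \<open>The ball of radius \<open>n\<close> around the core in the induced graph. It is
    finite, so the infinite sets \<open>A\<close> and \<open>B\<close> both leave it.\<close>
  define D where "D n = (\<Union>k\<in>K. \<Union>m\<le>n. {v. (R ^^ m) k v})" for n :: nat
  have Rsym: "R v u" if "R u v" for u v
    using that sym by (auto simp: R_def)
  have "finite {v. R u v}" for u
    using deg[of u] by (cases "u \<in> V") (auto simp: R_def conj_commute)
  then have finD: "finite (D n)" for n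
    using core by (simp add: D_def K_def finite_relpowp_image)
  have DV: "D n \<subseteq> V" for n
  proof -
    have "v \<in> V" if "(R ^^ m) k v" "k \<in> K" for m k v
      using that by (cases m) (auto simp: K_def R_def elim: relpowp_Suc_E)
    then show ?thesis
      by (auto simp: D_def)
  qed
  \<comment> \<open>The wanted double ray seen through the window from \<open>-n\<close> to
    \<open>n\<close>; values of \<open>g\<close> outside the window are irrelevant.\<close>
  define good where "good n g \<longleftrightarrow> (\<forall>i. \<bar>i\<bar> \<le> int n \<longrightarrow> g i \<in> D (nat \<bar>i\<bar>)) \<and>
    (\<forall>i j. \<bar>i\<bar> \<le> int n \<longrightarrow> \<bar>j\<bar> \<le> int n \<longrightarrow> (E (g i) (g j) \<longleftrightarrow> \<bar>i - j\<bar> = 1))"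
    for n and g :: "int \<Rightarrow> 'a"
  have "\<exists>g. good n g" for n
  proof -
    obtain a where a: "a \<in> A" "a \<notin> D n"
      using inf(1) finD[of n] by (meson finite_subset subsetI)
    obtain b where b: "b \<in> B" "b \<notin> D n"
      using inf(2) finD[of n] by (meson finite_subset subsetI)
    have "R\<^sup>*\<^sup>* a b"
      using conn a b sub unfolding R_def by blast
    then obtain f L where f: "f 0 = a" "f L = b" and step: "\<And>i. i < L \<Longrightarrow> R (f i) (f (Suc i))"
      and chord: "\<And>i j. i < j \<Longrightarrow> j \<le> L \<Longrightarrow> R (f i) (f j) \<Longrightarrow> j = Suc i"
      using shortest_walk_chordless by metis
    have fV: "f i \<in> V" if "i \<le> L" for i
      using that step[of "i - 1"] f(1) a sub by (cases i) (auto simp: R_def)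
    have walk: "(R ^^ (j - i)) (f i) (f j)" if "i \<le> j" "j \<le> L" for i j
      unfolding relpowp_fun_conv using that step
      by (intro exI[of _ "\<lambda>k. f (i + k)"]) auto
    have walk': "(R ^^ (j - i)) (f j) (f i)" if "i \<le> j" "j \<le> L" for i j
      using relpowp_symp[OF Rsym walk[OF that]] .
    \<comment> \<open>At the first exit from \<open>A\<close> the walk cannot step directly into
      \<open>B\<close>, so \<open>f k\<close> lies in the core \<open>K\<close>.\<close>
    define k where "k = (LEAST i. f i \<notin> A)"
    have fL: "f L \<notin> A"
      using f b disj by auto
    then have fk: "f k \<notin> A"
      unfolding k_def by (rule LeastI)
    have kL: "k \<le> L"
      unfolding k_def using fL by (rule Least_le)
    have k0: "k \<noteq> 0"
      using fk f a by metis
    have "f (k - 1) \<in> A"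
      using not_less_Least[of "k - 1" "\<lambda>i. f i \<notin> A"] k0 unfolding k_def[symmetric] by auto
    moreover have "R (f (k - 1)) (f k)"
      using step[of "k - 1"] k0 kL by auto
    ultimately have fkK: "f k \<in> K"
      using no_edge fk fV[OF kL] by (auto simp: K_def R_def)
    \<comment> \<open>Otherwise the reversed initial segment, of length \<open>k\<close>, would put
      \<open>a\<close> into \<open>D n\<close>; the next bound follows in the same way from
      \<open>b\<close>.\<close>
    have "n < k"
      using a f walk'[of 0 k] kL fkK by (force simp: D_def)
    have "n < L - k"
      using b f walk[of k L] kL fkK by (force simp: D_def)
    \<comment> \<open>Index 0 is moved to the core vertex \<open>f k\<close>. Truncation by
      \<open>nat\<close> does no harm inside the window since \<open>n < k\<close>.\<close>
    define g where "g i = f (nat (int k + i))" for i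
    have "g i \<in> D (nat \<bar>i\<bar>)" if "\<bar>i\<bar> \<le> int n" for i
    proof (cases "i \<ge> 0")
      case True
      then have "(R ^^ nat i) (f k) (g i)"
        using walk[of k "nat (int k + i)"] that \<open>n < L - k\<close> by (simp add: g_def nat_add_distrib)
      then show ?thesis
        using fkK True by (auto simp: D_def)
    next
      case False
      then have "k - nat (int k + i) = nat (- i)"
        using that \<open>n < k\<close> by linarith
      then have "(R ^^ nat (- i)) (f k) (g i)"
        using walk'[of "nat (int k + i)" k] False that \<open>n < k\<close> kL by (simp add: g_def)
      then show ?thesis
        using fkK False by (auto simp: D_def)
    qed
    moreover have "E (g i) (g j) \<longleftrightarrow> \<bar>i - j\<bar> = 1" if "\<bar>i\<bar> \<le> int n" "\<bar>j\<bar> \<le> int n" for i j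
    proof -
      have forward: "E (f p) (f q) \<longleftrightarrow> q = Suc p" if "p < q" "q \<le> L" for p q
        using chord[OF that] step[of p] that fV[of p] fV[of q] by (auto simp: R_def)
      define p q where "p = nat (int k + i)" and "q = nat (int k + j)"
      have pq: "int p = int k + i" "int q = int k + j" "p \<le> L" "q \<le> L"
        using that \<open>n < k\<close> \<open>n < L - k\<close> by (auto simp: p_def q_def)
      have "E (f p) (f q) \<longleftrightarrow> \<bar>int p - int q\<bar> = 1"
      proof (cases p q rule: linorder_cases)
        case less
        then show ?thesis using forward[of p q] pq by auto
      next
        case equal
        then show ?thesis using irrefl by auto
      next
        case greater
        then show ?thesis using forward[of q p] pq sym[of "f p" "f q"] sym[of "f q" "f p"] by auto
      qed
      then show ?thesis
        using pq by (simp add: g_def p_def q_def)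
    qed
    ultimately show ?thesis
      by (auto simp: good_def)
  qed
  then obtain g where g: "\<And>n. good n (g n)"
    by metis
  \<comment> \<open>Pairing the coordinates \<open>i\<close> and \<open>-i\<close> turns
    integer-indexed sequences into the sequences over the naturals that the limit lemma
    handles.\<close>
  have "\<exists>f. \<forall>m. \<exists>n\<ge>m. \<forall>i\<le>m. (g n (int i), g n (- int i)) = f i"
  proof (rule finite_choice_limit)
    show "finite (D i \<times> D i)" for i
      using finD by blast
    show "(g n (int i), g n (- int i)) \<in> D i \<times> D i" if "i \<le> n" for n i
      using g[of n] that unfolding good_def
      by (metis abs_minus_cancel abs_of_nat mem_Times_iff fst_conv snd_conv nat_int of_nat_le_iff)
  qed
  then obtain h where h: "\<And>m. \<exists>n\<ge>m. \<forall>i\<le>m. (g n (int i), g n (- int i)) = h i"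
    by blast
  define \<pi> where "\<pi> i = (if 0 \<le> i then fst (h (nat i)) else snd (h (nat (- i))))" for i :: int
  have approx: "\<exists>n. m \<le> n \<and> (\<forall>i. \<bar>i\<bar> \<le> int m \<longrightarrow> \<pi> i = g n i)" for m
  proof -
    obtain n where n: "n \<ge> m" "\<And>i. i \<le> m \<Longrightarrow> h i = (g n (int i), g n (- int i))"
      using h[of m] by metis
    have "\<pi> i = g n i" if "\<bar>i\<bar> \<le> int m" for i
      using that n(2)[of "nat i"] n(2)[of "nat (- i)"] by (auto simp: \<pi>_def)
    then show ?thesis
      using n(1) by blast
  qed
  have "\<pi> i \<in> V" for i
  proof -
    obtain n where "nat \<bar>i\<bar> \<le> n" "\<pi> i = g n i"
      using approx[of "nat \<bar>i\<bar>"] by auto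
    then show ?thesis
      using g[of n] DV unfolding good_def by (metis nat_le_iff subsetD)
  qed
  moreover have "E (\<pi> i) (\<pi> j) \<longleftrightarrow> \<bar>i - j\<bar> = 1" for i j
  proof -
    define m where "m = nat (max \<bar>i\<bar> \<bar>j\<bar>)"
    have m: "\<bar>i\<bar> \<le> int m" "\<bar>j\<bar> \<le> int m"
      by (auto simp: m_def)
    obtain n where "m \<le> n" "\<pi> i = g n i" "\<pi> j = g n j"
      using approx[of m] m by blast
    moreover from this have "\<bar>i\<bar> \<le> int n" "\<bar>j\<bar> \<le> int n"
      using m by auto
    ultimately show ?thesis
      using g[of n] unfolding good_def by auto
  qed
  ultimately show ?thesis
    by blast
qed

text \<open>If two positions carry the same vertex, then \<open>i + 1\<close> and
  \<open>i - 1\<close> are both at distance 1 from \<open>j\<close>, which leaves only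
  \<open>i = j\<close>.\<close>

lemma inj_if_adjacent_iff_consecutive:
  fixes \<pi> :: "int \<Rightarrow> 'a"
  assumes "\<And>i j. E (\<pi> i) (\<pi> j) \<longleftrightarrow> \<bar>i - j\<bar> = 1"
  shows "inj \<pi>"
proof (rule injI)
  fix i j
  assume "\<pi> i = \<pi> j"
  then have "E (\<pi> j) (\<pi> (i + 1))" "E (\<pi> j) (\<pi> (i - 1))"
    using assms[of i "i + 1"] assms[of i "i - 1"] by auto
  then show "i = j"
    unfolding assms by linarith
qed

section \<open>Arcs in the plane\<close>

text \<open>A disc stays connected when one point is removed, but the inverse of the arc would map
  the punctured disc onto a set of reals that omits an intermediate value.\<close>

lemma interior_arc_image_empty:
  fixes g :: "real \<Rightarrow> complex"
  assumes "arc g"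
  shows "interior (path_image g) = {}"
proof (rule ccontr)
  assume "interior (path_image g) \<noteq> {}"
  then obtain x r where r: "r > 0" "ball x r \<subseteq> path_image g"
    by (meson ex_in_conv mem_interior)
  obtain h where h: "homeomorphism {0..1} (path_image g) g h"
    using homeomorphism_arc[OF assms] by blast
  have hinv: "g (h y) = y" if "y \<in> ball x r" for y
    using h r that by (auto simp: homeomorphism_def)
  have "infinite (ball x r)"
    using r(1) by (meson bounded_ball finite_imp_not_open open_ball ball_eq_empty not_le)
  then obtain y z where yz: "y \<in> ball x r" "z \<in> ball x r" "h y < h z"
    by (metis (no_types, lifting) hinv finite.emptyI finite_insert finite_subset insertI1
        linorder_neqE subsetI)
  define b where "b = (h y + h z) / 2"
  have ghb: "h (g b) = b"
  proof -
    have "h y \<in> {0..1}" "h z \<in> {0..1}"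
      using h r yz unfolding homeomorphism_def by blast+
    then have "b \<in> {0..1}"
      by (auto simp: b_def)
    then show ?thesis
      using h by (auto simp: homeomorphism_def)
  qed
  have "connected (ball x r - {g b})"
    by (rule connected_open_delete) auto
  moreover have "continuous_on (ball x r - {g b}) h"
    using h r by (meson Diff_subset continuous_on_subset homeomorphism_def subset_trans)
  ultimately have "connected (h ` (ball x r - {g b}))"
    using connected_continuous_image by blast
  moreover have "y \<noteq> g b" "z \<noteq> g b"
    using ghb yz(3) by (auto simp: b_def)
  ultimately have "b \<in> h ` (ball x r - {g b})"
    using yz connectedD_interval[of _ "h y" "h z" b] by (auto simp: b_def)
  then show False
    using hinv by auto
qed

lemma adj_sym: "adj H u v \<Longrightarrow> adj H v u"
  by (simp add: adj_def insert_commute)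

section \<open>Local finiteness of the drawing\<close>

locale discrete_plane_graph =
  fixes G :: plane_drawing
  assumes in_class: "G \<in> class_G"
begin

abbreviation arc_of :: "complex set \<Rightarrow> complex set" where
  "arc_of e \<equiv> path_image (curve G e)"

text \<open>Vertices need no separate mention: a connected graph with infinitely many vertices has
  no isolated vertex, so this set is the whole drawing and the faces are the components of its
  complement.\<close>

definition skeleton :: "complex set" where
  "skeleton = (\<Union>e\<in>edges G. arc_of e)"

lemma class_facts:
  shows simple: "simple_graph G" and inf_verts: "infinite (verts G)"
    and loc_fin: "locally_finite G" and conn_graph: "connected_graph G"
    and no_vertex_limit: "\<not> x islimpt verts G"
    and no_edge_limit: "\<not> edge_accumulation_point G x"
    and face_bounded: "F \<in> faces G \<Longrightarrow> bounded F"
  using in_class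
  by (auto simp: class_G_def plane_graph_def two_connected_def vertex_accumulation_point_def)

lemma edge_arc: "e \<in> edges G \<Longrightarrow> arc (curve G e)"
  and edge_ends: "e \<in> edges G \<Longrightarrow> {curve G e 0, curve G e 1} = e"
  and arc_verts: "e \<in> edges G \<Longrightarrow> arc_of e \<inter> verts G = e"
  and arcs_meet: "e \<in> edges G \<Longrightarrow> f \<in> edges G \<Longrightarrow> e \<noteq> f \<Longrightarrow> arc_of e \<inter> arc_of f \<subseteq> verts G"
  using in_class by (auto simp: class_G_def plane_graph_def pathstart_def pathfinish_def)

lemma edge_subset_verts: "e \<in> edges G \<Longrightarrow> e \<subseteq> verts G"
  and edge_subset_arc: "e \<in> edges G \<Longrightarrow> e \<subseteq> arc_of e"
  using arc_verts by auto

lemma edge_inj: "e \<in> edges G \<Longrightarrow> inj_on (curve G e) {0..1}"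
  using edge_arc by (auto simp: arc_def)

text \<open>Distinct edges meet only in vertices, and the only vertices on an edge are its ends,
  which injectivity keeps apart from interior parameters.\<close>

lemma inner_point_unique_edge:
  assumes "e \<in> edges G" "f \<in> edges G" "r \<in> {0<..<1}" "curve G e r \<in> arc_of f"
  shows "f = e"
proof (rule ccontr)
  assume "f \<noteq> e"
  have "curve G e r \<in> arc_of e"
    using assms by (auto simp: path_image_def)
  then have "curve G e r \<in> {curve G e 0, curve G e 1}"
    using arcs_meet[OF assms(1,2)] assms \<open>f \<noteq> e\<close> arc_verts[OF assms(1)] edge_ends[OF assms(1)]
    by blast
  then show False
    using edge_inj[OF assms(1)] assms(3) by (auto dest: inj_onD)
qed

text \<open>At a vertex this is local finiteness of the graph; any other point lies on at most one
  edge.\<close>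

lemma finite_edges_through: "finite {e \<in> edges G. x \<in> arc_of e}"
proof (cases "x \<in> verts G")
  case True
  then have "{e \<in> edges G. x \<in> arc_of e} \<subseteq> {e \<in> edges G. x \<in> e}"
    using arc_verts by blast
  then show ?thesis
    using True loc_fin finite_subset by (auto simp: locally_finite_def)
next
  case False
  then have "e = f" if "e \<in> edges G" "x \<in> arc_of e" "f \<in> edges G" "x \<in> arc_of f" for e f
    using arcs_meet that by blast
  then show ?thesis
    by (metis (no_types, lifting) CollectD finite.simps finite_subset insertCI subsetI)
qed

lemma edges_locally_finite:
  obtains U where "open U" "x \<in> U" "finite {e \<in> edges G. arc_of e \<inter> U \<noteq> {}}"
proof -
  obtain U where "open U" "x \<in> U" "\<And>e. e \<in> edges G \<Longrightarrow> arc_of e \<inter> U \<noteq> {} \<Longrightarrow> x \<in> arc_of e"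
    using no_edge_limit[of x] unfolding edge_accumulation_point_def by blast
  moreover from this have "finite {e \<in> edges G. arc_of e \<inter> U \<noteq> {}}"
    using finite_edges_through[of x] by (auto elim!: rev_finite_subset)
  ultimately show ?thesis
    using that by blast
qed

lemma finite_edges_meeting_compact:
  assumes "compact S"
  shows "finite {e \<in> edges G. arc_of e \<inter> S \<noteq> {}}"
proof -
  define \<U> where "\<U> = {U. open U \<and> finite {e \<in> edges G. arc_of e \<inter> U \<noteq> {}}}"
  have "S \<subseteq> \<Union>\<U>"
  proof
    fix x
    show "x \<in> \<Union>\<U>"
      by (rule edges_locally_finite[of x]) (auto simp: \<U>_def)
  qed
  moreover have "\<And>U. U \<in> \<U> \<Longrightarrow> open U"
    by (simp add: \<U>_def)
  ultimately obtain \<D> where D: "\<D> \<subseteq> \<U>" "finite \<D>" "S \<subseteq> \<Union>\<D>"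
    using compactE[OF assms] by blast
  have "finite (\<Union>U\<in>\<D>. {e \<in> edges G. arc_of e \<inter> U \<noteq> {}})"
    using D(1,2) by (auto simp: \<U>_def)
  moreover have "{e \<in> edges G. arc_of e \<inter> S \<noteq> {}} \<subseteq> (\<Union>U\<in>\<D>. {e \<in> edges G. arc_of e \<inter> U \<noteq> {}})"
    using D(3) by blast
  ultimately show ?thesis
    using finite_subset by blast
qed

text \<open>Near each point only finitely many pieces matter. Pieces \<open>K e\<close> and
  subfamilies \<open>E\<close> are allowed so that the lemma also covers the drawing with subarcs or
  edges removed.\<close>

lemma closed_Union_edge_parts:
  assumes "E \<subseteq> edges G" "\<And>e. e \<in> E \<Longrightarrow> closed (K e)" "\<And>e. e \<in> E \<Longrightarrow> K e \<subseteq> arc_of e"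
  shows "closed (\<Union>e\<in>E. K e)"
  unfolding closed_def
proof (rule Topological_Spaces.openI)
  fix x
  assume x: "x \<in> - (\<Union>e\<in>E. K e)"
  obtain U where U: "open U" "x \<in> U" "finite {e \<in> edges G. arc_of e \<inter> U \<noteq> {}}"
    using edges_locally_finite by blast
  define E' where "E' = {e \<in> E. arc_of e \<inter> U \<noteq> {}}"
  have "finite E'"
    by (rule finite_subset[OF _ U(3)]) (use assms(1) in \<open>auto simp: E'_def\<close>)
  then have "open (U - (\<Union>e\<in>E'. K e))"
    using U(1) assms(2) by (intro open_Diff closed_UN) (auto simp: E'_def)
  moreover have "x \<in> U - (\<Union>e\<in>E'. K e)"
    using x U(2) by (auto simp: E'_def)
  moreover have "U - (\<Union>e\<in>E'. K e) \<subseteq> - (\<Union>e\<in>E. K e)"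
    using assms(3) by (auto simp: E'_def)
  ultimately show "\<exists>T. open T \<and> x \<in> T \<and> T \<subseteq> - (\<Union>e\<in>E. K e)"
    by blast
qed

lemma closed_arc_of: "e \<in> edges G \<Longrightarrow> closed (arc_of e)"
  using edge_arc by (simp add: closed_arc_image)

lemma closed_skeleton: "closed skeleton"
  unfolding skeleton_def by (rule closed_Union_edge_parts) (auto simp: closed_arc_of)

lemma arc_subset_skeleton: "e \<in> edges G \<Longrightarrow> arc_of e \<subseteq> skeleton"
  by (auto simp: skeleton_def)

lemma vertex_on_edge:
  assumes "v \<in> verts G"
  obtains e where "e \<in> edges G" "v \<in> e"
proof -
  obtain u where "u \<in> verts G" "u \<noteq> v"
    using inf_verts by (metis finite.emptyI finite_insert finite_subset insertI1 subsetI)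
  then have "(adj G)\<^sup>*\<^sup>* v u"
    using conn_graph assms by (auto simp: connected_graph_def)
  then obtain w where "adj G v w"
    using \<open>u \<noteq> v\<close> by (metis converse_rtranclpE)
  then show ?thesis
    using that by (auto simp: adj_def)
qed

lemma verts_subset_skeleton: "verts G \<subseteq> skeleton"
  using vertex_on_edge edge_subset_arc arc_subset_skeleton by blast

lemma faces_eq: "faces G = components (- skeleton)"
  using verts_subset_skeleton unfolding faces_def skeleton_def[symmetric]
  by (simp add: sup.absorb2)

lemma face_open: "F \<in> faces G \<Longrightarrow> open F"
  and face_connected: "F \<in> faces G \<Longrightarrow> connected F"
  and face_disjoint_skeleton: "F \<in> faces G \<Longrightarrow> F \<inter> skeleton = {}"
  and frontier_face_subset: "F \<in> faces G \<Longrightarrow> frontier F \<subseteq> skeleton"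
  unfolding faces_eq
  using closed_skeleton open_components[of "- skeleton" F] in_components_connected[of F]
    in_components_subset[of F "- skeleton"] frontier_of_components_closed_complement[of skeleton F]
  by auto

lemma frontier_face: "F \<in> faces G \<Longrightarrow> frontier F = closure F - F"
  by (simp add: face_open frontier_def interior_open)

lemma finite_verts_compact: "compact S \<Longrightarrow> finite (S \<inter> verts G)"
  using no_vertex_limit by (metis finite_not_islimpt_in_compact)

section \<open>Edges and the faces around them\<close>

text \<open>Only the open subarc is removed, so its end points stay and the remainder is closed.
  With parameters 0 and 1 the inside of an edge disappears while its two vertices remain.\<close>

definition skeleton_minus :: "complex set \<Rightarrow> real \<Rightarrow> real \<Rightarrow> complex set" where
  "skeleton_minus e s t = skeleton - curve G e ` {s<..<t}"

text \<open>Brings the set into a form to which \<open>closed_Union_edge_parts\<close> applies. No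
  other edge loses a point, because inner points of \<open>e\<close> lie on \<open>e\<close>
  alone.\<close>

lemma skeleton_minus_eq:
  assumes "e \<in> edges G" "0 \<le> s" "s \<le> t" "t \<le> 1"
  shows "skeleton_minus e s t =
    (\<Union>f\<in>edges G. if f = e then curve G e ` {0..s} \<union> curve G e ` {t..1} else arc_of f)"
    (is "_ = ?rhs")
proof (intro set_eqI iffI)
  fix x
  assume x: "x \<in> skeleton_minus e s t"
  then obtain f where f: "f \<in> edges G" "x \<in> arc_of f"
    by (auto simp: skeleton_minus_def skeleton_def)
  show "x \<in> ?rhs"
  proof (cases "f = e")
    case True
    then obtain r where r: "x = curve G e r" "r \<in> {0..1}"
      using f by (auto simp: path_image_def)
    moreover have "r \<notin> {s<..<t}"
      using x r by (auto simp: skeleton_minus_def)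
    ultimately have "r \<in> {0..s} \<or> r \<in> {t..1}"
      by auto
    then show ?thesis
      using assms(1) r(1) by (intro UN_I[of e]) auto
  next
    case False
    then show ?thesis
      using f by (intro UN_I[of f]) auto
  qed
next
  fix x
  assume "x \<in> ?rhs"
  then obtain f where f: "f \<in> edges G"
    "x \<in> (if f = e then curve G e ` {0..s} \<union> curve G e ` {t..1} else arc_of f)"
    by blast
  have "curve G e ` {0..s} \<union> curve G e ` {t..1} \<subseteq> arc_of e"
    using assms by (auto simp: path_image_def)
  then have "x \<in> skeleton"
    using f assms(1) arc_subset_skeleton by (metis subsetD)
  moreover have "x \<noteq> curve G e r" if "r \<in> {s<..<t}" for r
  proof (cases "f = e")
    case True
    then obtain r' where "x = curve G e r'" "r' \<in> {0..s} \<or> r' \<in> {t..1}"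
      using f(2) by auto
    then show ?thesis
      using edge_inj[OF assms(1)] that assms(2-4) by (auto dest: inj_onD)
  next
    case False
    then show ?thesis
      using inner_point_unique_edge[OF assms(1) f(1), of r] f(2) that assms(2-4) by auto
  qed
  ultimately show "x \<in> skeleton_minus e s t"
    unfolding skeleton_minus_def by blast
qed

lemma curve_continuous: "e \<in> edges G \<Longrightarrow> continuous_on {0..1} (curve G e)"
  using edge_arc by (simp add: arc_def path_def)

lemma compact_subarc:
  assumes "e \<in> edges G" "0 \<le> s" "t \<le> 1"
  shows "compact (curve G e ` {s..t})"
  by (rule compact_continuous_image)
    (use assms in \<open>auto intro: continuous_on_subset[OF curve_continuous]\<close>)

lemma closed_skeleton_minus:
  assumes "e \<in> edges G" "0 \<le> s" "s \<le> t" "t \<le> 1"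
  shows "closed (skeleton_minus e s t)"
  unfolding skeleton_minus_eq[OF assms]
proof (rule closed_Union_edge_parts)
  fix f
  assume "f \<in> edges G"
  then show "closed (if f = e then curve G e ` {0..s} \<union> curve G e ` {t..1} else arc_of f)"
    using assms by (auto simp: closed_arc_of intro!: closed_Un compact_imp_closed compact_subarc)
  show "(if f = e then curve G e ` {0..s} \<union> curve G e ` {t..1} else arc_of f) \<subseteq> arc_of f"
    using assms by (auto simp: path_image_def)
qed simp

lemma curve_eq_iff:
  assumes "e \<in> edges G" "r \<in> {0..1}" "r' \<in> {0..1}"
  shows "curve G e r = curve G e r' \<longleftrightarrow> r = r'"
  using edge_inj[OF assms(1)] assms(2,3) by (auto dest: inj_onD)

lemma curve_mem_image_iff:
  assumes "e \<in> edges G" "r \<in> {0..1}" "I \<subseteq> {0..1}"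
  shows "curve G e r \<in> curve G e ` I \<longleftrightarrow> r \<in> I"
  using edge_inj[OF assms(1)] assms(2,3) by (simp add: inj_on_image_mem_iff)

lemma subarc_Int_skeleton_minus:
  assumes "e \<in> edges G" "0 \<le> s" "s \<le> t" "t \<le> 1"
  shows "curve G e ` {s..t} \<inter> skeleton_minus e s t = {curve G e s, curve G e t}"
proof -
  have "curve G e ` {s..t} \<subseteq> skeleton"
    using assms arc_subset_skeleton[OF assms(1)] by (force simp: path_image_def)
  moreover have "curve G e s \<notin> curve G e ` {s<..<t}" "curve G e t \<notin> curve G e ` {s<..<t}"
    using assms curve_eq_iff[OF assms(1)] by force+
  moreover have "{s..t} = {s<..<t} \<union> {s, t}"
    using assms by auto
  ultimately show ?thesis
    unfolding skeleton_minus_def by auto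
qed

text \<open>If a face touches the open arc of an edge but misses an open subarc of it, then deleting
  this subarc does not merge the face with anything. But the two remaining pieces of the edge are
  arcs attached to the rest of the graph at one point each, which by Janiszewski's theorem
  do not separate the face from the deleted subarc.\<close>

lemma edge_subset_closure_face:
  assumes F: "F \<in> faces G" and e: "e \<in> edges G"
    and meet: "closure F \<inter> curve G e ` {0<..<1} \<noteq> {}"
  shows "arc_of e \<subseteq> closure F"
proof -
  let ?c = "curve G e"
  have inner: "?c m \<in> closure F" if m: "m \<in> {0<..<1}" for m
  proof (rule ccontr)
    assume out: "?c m \<notin> closure F"
    obtain d where d: "d > 0" "\<And>r. r \<in> {0..1} \<Longrightarrow> dist r m < d \<Longrightarrow> ?c r \<notin> closure F"
    proof -
      obtain \<epsilon> where "\<epsilon> > 0" "ball (?c m) \<epsilon> \<subseteq> - closure F"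
        using out by (metis ComplI closed_closure open_Compl open_contains_ball)
      moreover from \<open>\<epsilon> > 0\<close> obtain d where "d > 0" "\<forall>r\<in>{0..1}. dist r m < d \<longrightarrow> dist (?c r) (?c m) < \<epsilon>"
        using curve_continuous[OF e] m unfolding continuous_on_iff
        by (meson greaterThanLessThan_subseteq_atLeastAtMost_iff order_refl subsetD)
      ultimately show ?thesis
        using that[of d] by (auto simp: dist_commute subset_iff)
    qed
    \<comment> \<open>The bounds keep the subarc strictly inside the edge and within parameter
      distance \<open>d\<close> of \<open>m\<close>, hence away from
      \<open>closure F\<close>.\<close>
    define s t where "s = max (m/2) (m - d/2)" and "t = min ((m+1)/2) (m + d/2)"
    have st: "0 < s" "s < m" "m < t" "t < 1"
      using m d(1) by (auto simp: s_def t_def min_less_iff_disj less_max_iff_disj)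
    have gap: "?c r \<notin> closure F" if "r \<in> {s<..<t}" for r
    proof -
      have "r \<in> {0..1}" "dist r m < d"
        using that st d(1) by (auto simp: dist_real_def s_def t_def)
      then show ?thesis
        using d(2) by blast
    qed
    define T where "T = skeleton_minus e 0 1"
    define S1 S2 where "S1 = ?c ` {0..s}" and "S2 = ?c ` {t..1}"
    have S1: "S1 = path_image (subpath 0 s ?c)" "arc (subpath 0 s ?c)"
      and S2: "S2 = path_image (subpath t 1 ?c)" "arc (subpath t 1 ?c)"
      using st edge_arc[OF e] by (auto simp: S1_def S2_def path_image_subpath arc_subpath_arc)
    have clT: "closed T" "compact S1" "compact S2"
      using e st by (auto simp: T_def S1_def S2_def closed_skeleton_minus compact_subarc)
    have S_sk: "S1 \<subseteq> skeleton" "S2 \<subseteq> skeleton"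
      using arc_subset_skeleton[OF e] st by (force simp: S1_def S2_def path_image_def)+
    have all: "{?c 0, ?c 1} = arc_of e \<inter> T"
      using subarc_Int_skeleton_minus[OF e, of 0 1] by (simp add: T_def path_image_def)
    have S1T: "S1 \<inter> T = {?c 0}"
    proof -
      have "S1 \<subseteq> arc_of e" "?c 0 \<in> S1" "?c 1 \<notin> S1"
        using st curve_mem_image_iff[OF e, of 1 "{0..s}"] by (auto simp: S1_def path_image_def)
      then show ?thesis
        using all by blast
    qed
    have S2T: "S2 \<inter> (S1 \<union> T) = {?c 1}"
    proof -
      have "S2 \<subseteq> arc_of e" "?c 1 \<in> S2" "?c 0 \<notin> S2" "S1 \<inter> S2 = {}"
        using st curve_mem_image_iff[OF e, of 0 "{t..1}"]
          inj_on_image_Int[OF edge_inj[OF e], of "{0..s}" "{t..1}"]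
        by (auto simp: S1_def S2_def path_image_def)
      moreover from this have "S2 \<inter> (S1 \<union> T) = S2 \<inter> (arc_of e \<inter> T)"
        by blast
      ultimately show ?thesis
        unfolding all[symmetric] by auto
    qed
    obtain a where a: "a \<in> F"
      using F by (metis all_not_in_conv faces_eq in_components_nonempty)
    obtain r where r: "r \<in> {0<..<1}" "?c r \<in> closure F"
      using meet by blast
    \<comment> \<open>The face, its limit point \<open>?c r\<close> and the open edge together form
      a connected set. It avoids \<open>T\<close> because \<open>T\<close> lacks the open
      edge.\<close>
    have "connected (insert (?c r) F)"
      using r by (intro connected_intermediate_closure[OF face_connected[OF F]])
        (auto intro: closure_subset[THEN subsetD])
    moreover have "connected (?c ` {0<..<1})"
      by (intro connected_continuous_image continuous_on_subset[OF curve_continuous[OF e]]) auto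
    ultimately have "connected (insert (?c r) F \<union> ?c ` {0<..<1})"
      using r by (intro connected_Un) auto
    moreover have "insert (?c r) F \<union> ?c ` {0<..<1} \<subseteq> - T"
      using face_disjoint_skeleton[OF F] r by (auto simp: T_def skeleton_minus_def)
    ultimately have ccT: "connected_component (- T) a (?c m)"
      using a m unfolding connected_component_def by blast
    have "?c m \<notin> S1" "?c m \<notin> S2"
      using st m curve_mem_image_iff[OF e, of m "{0..s}"] curve_mem_image_iff[OF e, of m "{t..1}"]
      by (auto simp: S1_def S2_def)
    moreover have "a \<notin> S1" "a \<notin> S2"
      using a S_sk face_disjoint_skeleton[OF F] by auto
    ultimately have cc: "connected_component (- S1) a (?c m)" "connected_component (- S2) a (?c m)"
      using connected_arc_complement[OF S1(2)] connected_arc_complement[OF S2(2)]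
      unfolding S1(1)[symmetric] S2(1)[symmetric]
      by (simp_all add: connected_iff_connected_component)
    have "connected_component (- (S1 \<union> T)) a (?c m)"
      by (rule Janiszewski) (use clT cc ccT S1T in auto)
    then have "connected_component (- (S2 \<union> (S1 \<union> T))) a (?c m)"
      by (rule Janiszewski[rotated 4]) (use clT cc S2T in \<open>auto intro: closed_Un compact_imp_closed\<close>)
    then obtain D where D: "connected D" "a \<in> D" "?c m \<in> D" "D \<subseteq> - (S2 \<union> (S1 \<union> T))"
      by (auto simp: connected_component_def)
    have "D \<inter> skeleton \<subseteq> ?c ` {s<..<t}"
    proof
      fix y
      assume y: "y \<in> D \<inter> skeleton"
      then have "y \<notin> T" "y \<notin> S1" "y \<notin> S2"
        using D(4) by auto
      then obtain q where q: "y = ?c q" "q \<in> {0<..<1}"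
        using y by (auto simp: T_def skeleton_minus_def)
      then have "q \<notin> {0..s}" "q \<notin> {t..1}"
        using \<open>y \<notin> S1\<close> \<open>y \<notin> S2\<close> unfolding S1_def S2_def by blast+
      then have "q \<in> {s<..<t}"
        using q(2) by auto
      then show "y \<in> ?c ` {s<..<t}"
        using q(1) by blast
    qed
    \<comment> \<open>The set \<open>D\<close> meets the skeleton only in the gap, which is off
      \<open>closure F\<close>, so it cannot cross the frontier of \<open>F\<close>. It would then
      lie in \<open>F\<close> although it contains \<open>?c m\<close>.\<close>
    then have "D \<inter> frontier F = {}"
      using frontier_face_subset[OF F] frontier_face[OF F] gap by blast
    then have "D \<subseteq> F"
      using connected_Int_frontier[OF D(1), of F] a D(2) by blast
    then show False
      using D(3) out closure_subset by blast
  qed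
  have "?c ` closure {0<..<1} \<subseteq> closure F"
  proof (rule image_closure_subset)
    show "continuous_on (closure {0<..<1}) ?c"
      using curve_continuous[OF e] by simp
  qed (use inner in auto)
  then show ?thesis
    by (simp add: path_image_def)
qed

text \<open>A small disc at the midpoint meets the skeleton only inside \<open>e\<close>. Since an
  arc has empty interior, the disc also meets a face, whose frontier it must then meet on the open
  edge; \<open>edge_subset_closure_face\<close> extends this to the whole edge.\<close>

lemma edge_in_closure_of_face:
  assumes e: "e \<in> edges G"
  obtains F where "F \<in> faces G" "arc_of e \<subseteq> closure F"
proof -
  let ?x = "curve G e (1/2)"
  have "?x \<notin> skeleton_minus e 0 1"
    by (simp add: skeleton_minus_def)
  then obtain r where r: "r > 0" "ball ?x r \<subseteq> - skeleton_minus e 0 1"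
    using closed_skeleton_minus[OF e, of 0 1]
    by (metis ComplI open_Compl open_contains_ball order_refl zero_le_one)
  have "\<not> ball ?x r \<subseteq> arc_of e"
    using interior_arc_image_empty[OF edge_arc[OF e]] r(1)
    by (metis ball_eq_empty interior_maximal open_ball subset_empty not_le)
  then obtain y where y: "y \<in> ball ?x r" "y \<notin> arc_of e"
    by blast
  have "?x \<in> skeleton"
    using arc_subset_skeleton[OF e] by (auto simp: path_image_def)
  have "y \<notin> skeleton"
    using y r by (auto simp: skeleton_minus_def path_image_def subset_iff)
  then obtain F where F: "F \<in> faces G" "y \<in> F"
    unfolding faces_eq by (metis ComplI UnionE Union_components)
  have "ball ?x r \<inter> frontier F \<noteq> {}"
  proof (rule connected_Int_frontier)
    have "?x \<in> ball ?x r - F"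
      using r(1) \<open>?x \<in> skeleton\<close> face_disjoint_skeleton[OF F(1)] by auto
    then show "ball ?x r - F \<noteq> {}"
      by blast
  qed (use y F in auto)
  then have "closure F \<inter> curve G e ` {0<..<1} \<noteq> {}"
    using frontier_face_subset[OF F(1)] r(2) frontier_face[OF F(1)]
    unfolding skeleton_minus_def by blast
  then show ?thesis
    using that edge_subset_closure_face F e by blast
qed

text \<open>A crosscut of one face at the edge, together with the subarc it cuts off, is a Jordan
  curve. Near the midpoint of the edge any two points off the graph and on the same side of this
  curve lie in the same face, again by Janiszewski's theorem, so at most two faces meet the edge.\<close>

lemma finite_faces_at_edge:
  assumes e: "e \<in> edges G"
  shows "finite {F \<in> faces G. arc_of e \<subseteq> closure F}"
proof (cases "{F \<in> faces G. arc_of e \<subseteq> closure F} = {}")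
  case True
  show ?thesis
    unfolding True by simp
next
  case False
  then obtain F1 where F1: "F1 \<in> faces G" "arc_of e \<subseteq> closure F1"
    by blast
  let ?c = "curve G e"
  have front: "arc_of e \<subseteq> frontier F1"
    using F1 frontier_face[of F1] face_disjoint_skeleton[of F1] arc_subset_skeleton[OF e] by blast
  \<comment> \<open>Relative openness in the frontier is what the density of accessible boundary
    points requires of the two target sets.\<close>
  have part_open: "openin (top_of_set (frontier F1)) (?c ` {s<..<t})" if "0 \<le> s" "s \<le> t" "t \<le> 1" for s t
  proof -
    have "?c ` {s<..<t} \<subseteq> arc_of e"
      using that by (auto simp: path_image_def)
    then have "?c ` {s<..<t} = frontier F1 \<inter> - skeleton_minus e s t"
      using front frontier_face_subset[OF F1(1)] by (auto simp: skeleton_minus_def)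
    then show ?thesis
      using closed_skeleton_minus[OF e that] by (simp add: openin_open_Int open_Compl)
  qed
  have "(?c ` {0<..<1/2}) \<inter> (?c ` {1/2<..<1}) = {}"
    by (subst inj_on_image_Int[OF edge_inj[OF e], symmetric]) auto
  moreover have ne: "?c ` {0<..<1/2} \<noteq> {}" "?c ` {1/2<..<1} \<noteq> {}"
    by auto
  ultimately have neq: "?c ` {0<..<1/2} \<noteq> ?c ` {1/2<..<1}"
    by blast
  \<comment> \<open>The crosscut ends on both halves of the edge, so the midpoint lies inside the
    subarc that it cuts off.\<close>
  obtain g where g: "arc g" "pathstart g \<in> ?c ` {0<..<1/2}" "pathfinish g \<in> ?c ` {1/2<..<1}"
    "g ` {0<..<1} \<subseteq> F1"
    using dense_accessible_frontier_point_pairs[OF face_open[OF F1(1)] face_connected[OF F1(1)]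
      part_open[of 0 "1/2"] part_open[of "1/2" 1] ne neq] by auto
  obtain s t where st: "0 < s" "s < 1/2" "1/2 < t" "t < 1"
    and gs: "pathstart g = ?c s" and gt: "pathfinish g = ?c t"
    using g(2,3) by auto
  have pg: "path_image g = {?c s, ?c t} \<union> g ` {0<..<1}"
  proof -
    have "{0..1} = {0, 1} \<union> {0<..<1::real}"
      by auto
    then show ?thesis
      using gs gt by (simp add: path_image_def pathstart_def pathfinish_def)
  qed
  define q where "q = subpath t s ?c"
  have q: "arc q" "path_image q = ?c ` {s..t}" "pathstart q = ?c t" "pathfinish q = ?c s"
    using st edge_arc[OF e] by (auto simp: q_def arc_subpath_arc path_image_subpath)
  have q_sk: "path_image q \<subseteq> skeleton"
    using q(2) arc_subset_skeleton[OF e] st by (force simp: path_image_def)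
  have J: "simple_path (g +++ q)" "pathfinish (g +++ q) = pathstart (g +++ q)"
  proof -
    have "path_image g \<inter> path_image q \<subseteq> {pathstart g, pathstart q}"
      using g(4) q_sk face_disjoint_skeleton[OF F1(1)] unfolding pg gs q(3) by blast
    then show "simple_path (g +++ q)"
      using simple_path_join_loop[OF g(1) q(1)] gs gt q by simp
  qed (use gs q in simp)
  define S where "S = path_image (g +++ q)"
  have S: "S = path_image g \<union> ?c ` {s..t}"
    using q gt by (simp add: S_def path_image_join)
  define T where "T = skeleton_minus e s t \<union> path_image g"
  have clT: "closed T" "compact S"
    using closed_skeleton_minus[OF e, of s t] st g(1) J(1)
    by (auto simp: T_def S_def closed_arc_image compact_simple_path_image)
  have ST: "S \<inter> T = path_image g"
    using subarc_Int_skeleton_minus[OF e, of s t] st pg by (auto simp: S T_def)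
  have skST: "skeleton \<subseteq> S \<union> T"
    by (auto simp: S T_def skeleton_minus_def)
  have "?c (1/2) \<in> skeleton"
    using arc_subset_skeleton[OF e] by (auto simp: path_image_def)
  moreover have "?c (1/2) \<noteq> ?c s" "?c (1/2) \<noteq> ?c t"
    using curve_eq_iff[OF e] st by auto
  ultimately have "?c (1/2) \<notin> T"
    using st pg g(4) face_disjoint_skeleton[OF F1(1)] by (auto simp: T_def skeleton_minus_def)
  then obtain r where r: "r > 0" "ball (?c (1/2)) r \<subseteq> - T"
    using clT(1) by (metis ComplI open_Compl open_contains_ball)
  let ?B = "ball (?c (1/2)) r"
  have side_off: "inside S \<subseteq> - S" "outside S \<subseteq> - S"
    using inside_Un_outside[of S] by blast+
  have Jordan: "connected (inside S)" "connected (outside S)"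
    using Jordan_inside_outside[OF J] by (auto simp: S_def)
  \<comment> \<open>The ball joins the points off \<open>T\<close> and \<open>W\<close> joins them
    off \<open>S\<close>. As \<open>S \<inter> T\<close> is the crosscut, a connected set, they are
    joined off \<open>S \<union> T\<close>, which contains the skeleton.\<close>
  have same_side: "connected_component (- skeleton) a b"
    if "a \<in> ?B" "b \<in> ?B" "connected W" "W \<subseteq> - S" "a \<in> W" "b \<in> W" for a b W
  proof -
    have "connected_component (- (S \<union> T)) a b"
    proof (rule Janiszewski)
      show "connected_component (- S) a b"
        using that unfolding connected_component_def by blast
      show "connected_component (- T) a b"
        using that r unfolding connected_component_def by (intro exI[of _ ?B]) auto
    qed (use clT ST g(1) connected_arc_image in auto)
    then show ?thesis
      using skST by (auto intro: connected_component_of_subset)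
  qed
  have "\<exists>y. y \<in> F \<inter> ?B" if "F \<in> faces G" "arc_of e \<subseteq> closure F" for F
  proof -
    have "?c (1/2) \<in> closure F"
      using that(2) by (auto simp: path_image_def)
    then show ?thesis
      using r(1) by (metis IntI ball_eq_empty closure_approachable dist_commute mem_ball)
  qed
  then obtain y where y: "\<And>F. F \<in> faces G \<Longrightarrow> arc_of e \<subseteq> closure F \<Longrightarrow> y F \<in> F \<inter> ?B"
    by metis
  \<comment> \<open>Each face is recorded by the side of the Jordan curve on which its sample point
    near the midpoint lies.\<close>
  have "inj_on (\<lambda>F. y F \<in> inside S) {F \<in> faces G. arc_of e \<subseteq> closure F}"
  proof (rule inj_onI)
    fix F F'
    assume F: "F \<in> {F \<in> faces G. arc_of e \<subseteq> closure F}"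
      and F': "F' \<in> {F \<in> faces G. arc_of e \<subseteq> closure F}"
      and eq: "(y F \<in> inside S) = (y F' \<in> inside S)"
    have off: "y F \<in> inside S \<union> outside S" if "F \<in> {F \<in> faces G. arc_of e \<subseteq> closure F}" for F
    proof -
      have "y F \<notin> skeleton" "y F \<notin> T"
        using y[of F] that r(2) face_disjoint_skeleton[of F] by auto
      then have "y F \<notin> S"
        using S q(2) q_sk by (auto simp: T_def)
      then show ?thesis
        using inside_Un_outside[of S] by auto
    qed
    have "connected_component (- skeleton) (y F) (y F')"
    proof (cases "y F \<in> inside S")
      case True
      then show ?thesis
        using same_side[of "y F" "y F'" "inside S"] y[of F] y[of F'] F F' eq Jordan
          side_off by auto
    next
      case False
      then have "y F \<in> outside S" "y F' \<in> outside S"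
        using off[OF F] off[OF F'] eq by blast+
      then show ?thesis
        using same_side[of "y F" "y F'" "outside S"] y[of F] y[of F'] F F' Jordan side_off by auto
    qed
    then obtain D where "connected D" "D \<subseteq> - skeleton" "y F \<in> D" "y F' \<in> D"
      by (auto simp: connected_component_def)
    then show "F = F'"
      using joinable_components_eq[of D "- skeleton" F F'] F F' y[of F] y[of F']
      by (auto simp: faces_eq)
  qed
  then show ?thesis
    by (rule inj_on_finite[where B = "UNIV :: bool set"]) auto
qed

section \<open>Local finiteness of the matching graph and connectivity inside the skeleton\<close>

text \<open>Treats edges and diagonals alike: both ends lie on the closure of one face. The edge
  \<open>e\<close> at \<open>u\<close> is kept because faces are counted through the edges at a
  vertex.\<close>

lemma matching_adjD:
  assumes "adj (matching_graph G) u v"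
  obtains F e where "F \<in> faces G" "e \<in> edges G" "u \<in> e" "arc_of e \<subseteq> closure F" "v \<in> closure F"
proof (cases "{u, v} \<in> edges G")
  case True
  then obtain F where "F \<in> faces G" "arc_of {u, v} \<subseteq> closure F"
    using edge_in_closure_of_face by blast
  then show ?thesis
    using True edge_subset_arc[OF True] that[of F "{u, v}"] by auto
next
  case False
  then obtain F c where F: "F \<in> faces G" "boundary_cycle G F c" "u \<in> set c" "v \<in> set c"
    using assms unfolding adj_def matching_graph_def by (auto simp: doubleton_eq_iff)
  have on: "\<exists>e\<in>cycle_edges c. x \<in> e" if x: "x \<in> set c" for x
  proof -
    obtain i where "i < length c" "x = c ! i"
      using x by (auto simp: in_set_conv_nth)
    then have "{x, c ! (Suc i mod length c)} \<in> cycle_edges c"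
      by (auto simp: cycle_edges_def)
    then show ?thesis
      by blast
  qed
  have cyc: "e \<in> edges G" "arc_of e \<subseteq> closure F" if "e \<in> cycle_edges c" for e
    using that F(2) frontier_subset_closed[of "closure F"]
    by (auto simp: boundary_cycle_def is_cycle_def frontier_def)
  obtain e f where "e \<in> cycle_edges c" "u \<in> e" "f \<in> cycle_edges c" "v \<in> f"
    using on F by blast
  then show ?thesis
    using that[of F e] F(1) cyc edge_subset_arc by blast
qed

text \<open>Finitely many edges leave \<open>u\<close>, each borders finitely many faces, and the
  compact closure of a face contains finitely many vertices.\<close>

lemma matching_locally_finite:
  assumes "u \<in> verts G"
  shows "finite {v \<in> verts G. adj (matching_graph G) u v}"
proof -
  have "{v \<in> verts G. adj (matching_graph G) u v} \<subseteq>
    (\<Union>e\<in>{e \<in> edges G. u \<in> e}. \<Union>F\<in>{F \<in> faces G. arc_of e \<subseteq> closure F}. closure F \<inter> verts G)"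
    by (auto elim!: matching_adjD)
  moreover have "finite (closure F \<inter> verts G)" if "F \<in> faces G" for F
    using finite_verts_compact face_bounded[OF that] by (simp add: compact_closure)
  ultimately show ?thesis
    using finite_faces_at_edge loc_fin assms unfolding locally_finite_def
    by (elim finite_subset) (intro finite_UN_I, auto)
qed

lemma adj_imp_matching_adj: "adj G u v \<Longrightarrow> adj (matching_graph G) u v"
  by (simp add: adj_def matching_graph_def)

lemma matching_adj_irrefl: "\<not> adj (matching_graph G) u u"
proof -
  have "{u} \<notin> edges G"
    using simple by (auto simp: simple_graph_def doubleton_eq_iff)
  then show ?thesis
    by (auto simp: adj_def matching_graph_def doubleton_eq_iff)
qed

text \<open>Otherwise the edges with an end reachable from \<open>u\<close> and the remaining edges
  would give two closed sets separating \<open>C\<close>. An edge used by the walk need not lie in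
  \<open>C\<close>; only its ends must.\<close>

lemma connected_subset_skeleton_vertices_joined:
  assumes C: "connected C" "C \<subseteq> skeleton" and uv: "u \<in> C \<inter> verts G" "v \<in> C \<inter> verts G"
  shows "(\<lambda>x y. adj G x y \<and> x \<in> C \<inter> verts G \<and> y \<in> C \<inter> verts G)\<^sup>*\<^sup>* u v"
proof (rule ccontr)
  define R where "R = (\<lambda>x y. adj G x y \<and> x \<in> C \<inter> verts G \<and> y \<in> C \<inter> verts G)"
  define A where "A = {w. R\<^sup>*\<^sup>* u w}"
  assume "\<not> (\<lambda>x y. adj G x y \<and> x \<in> C \<inter> verts G \<and> y \<in> C \<inter> verts G)\<^sup>*\<^sup>* u v"
  then have "v \<notin> A"
    by (simp add: A_def R_def)
  have AC: "A \<subseteq> C \<inter> verts G"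
  proof
    fix w
    assume "w \<in> A"
    then have "R\<^sup>*\<^sup>* u w"
      by (simp add: A_def)
    then show "w \<in> C \<inter> verts G"
      by (induction) (use uv in \<open>auto simp: R_def\<close>)
  qed
  have closedA: "x \<in> A" if e: "e \<in> edges G" "e \<inter> A \<noteq> {}" "x \<in> e" "x \<in> C" for e x
  proof -
    obtain a where a: "a \<in> e" "a \<in> A"
      using e by blast
    show ?thesis
    proof (cases "x = a")
      case False
      then have "e = {a, x}"
        using a e(1,3) simple unfolding simple_graph_def by (metis doubleton_eq_iff insertE singletonD)
      then have "R a x"
        using a AC e edge_subset_verts[OF e(1)] by (auto simp: R_def adj_def)
      then show ?thesis
        using a by (auto simp: A_def)
    qed (use a in simp)
  qed
  define K where "K = (\<Union>e\<in>{e \<in> edges G. e \<inter> A \<noteq> {}}. arc_of e)"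
  define L where "L = (\<Union>e\<in>{e \<in> edges G. e \<inter> A = {}}. arc_of e)"
  have "closed K" "closed L"
    unfolding K_def L_def by (rule closed_Union_edge_parts; auto simp: closed_arc_of)+
  moreover have "C \<subseteq> K \<union> L"
  proof
    fix x
    assume "x \<in> C"
    then obtain e where "e \<in> edges G" "x \<in> arc_of e"
      using C(2) by (auto simp: skeleton_def)
    then show "x \<in> K \<union> L"
      by (cases "e \<inter> A = {}") (auto simp: K_def L_def)
  qed
  moreover have "K \<inter> L \<inter> C = {}"
  proof (rule ccontr)
    assume "K \<inter> L \<inter> C \<noteq> {}"
    then obtain x e f where x: "x \<in> C" and e: "e \<in> edges G" "e \<inter> A \<noteq> {}" "x \<in> arc_of e"
      and f: "f \<in> edges G" "f \<inter> A = {}" "x \<in> arc_of f"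
      by (auto simp: K_def L_def)
    have "x \<in> verts G"
      using e f arcs_meet[of e f] by auto
    then have "x \<in> e" "x \<in> f"
      using e f arc_verts by blast+
    then show False
      using closedA[OF e(1,2)] x f(2) by blast
  qed
  ultimately have "K \<inter> C = {} \<or> L \<inter> C = {}"
    using C(1) by (metis connected_closedD)
  moreover have "u \<in> A"
    by (simp add: A_def)
  then have "u \<in> K"
  proof -
    obtain f where "f \<in> edges G" "u \<in> f"
      using vertex_on_edge uv by blast
    then show ?thesis
      using \<open>u \<in> A\<close> edge_subset_arc[of f] unfolding K_def by blast
  qed
  moreover have "v \<in> L"
  proof -
    obtain f where f: "f \<in> edges G" "v \<in> f"
      using vertex_on_edge uv by blast
    then have "f \<inter> A = {}"
      using closedA[of f v] uv \<open>v \<notin> A\<close> by blast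
    then show ?thesis
      using f edge_subset_arc[of f] unfolding L_def by blast
  qed
  ultimately show False
    using uv by blast
qed

end

section \<open>Euclidean geometry of acute faces and of the two far regions\<close>

text \<open>Two points of the sector enclose an angle of at most \<zeta>, so their inner product is
  at least \<open>cos \<zeta>\<close> times the product of their norms. This closed condition passes
  to the closure, where 0 is excluded.\<close>

lemma acute_imp_inner_pos:
  assumes "acute \<zeta> F" "0 < \<zeta>" "\<zeta> < pi / 2" and zw: "z \<in> closure F" "w \<in> closure F"
  shows "inner z w > 0"
proof -
  obtain \<alpha> where \<alpha>: "F \<subseteq> sector \<alpha> \<zeta>" and nz: "0 \<notin> closure F"
    using assms(1) by (auto simp: acute_def)
  have "F \<times> F \<subseteq> {p. cos \<zeta> * norm (fst p) * norm (snd p) \<le> inner (fst p) (snd p)}"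
  proof clarsimp
    fix x y
    assume "x \<in> F" "y \<in> F"
    then obtain r \<theta> s \<phi> where x: "x = of_real r * cis \<theta>" "0 \<le> r" "\<alpha> \<le> \<theta>" "\<theta> \<le> \<alpha> + \<zeta>"
      and y: "y = of_real s * cis \<phi>" "0 \<le> s" "\<alpha> \<le> \<phi>" "\<phi> \<le> \<alpha> + \<zeta>"
      using \<alpha> unfolding sector_def by blast
    have "cos \<zeta> \<le> cos \<bar>\<theta> - \<phi>\<bar>"
      using x y assms(2,3) by (intro cos_monotone_0_pi_le) auto
    then have "cos \<zeta> \<le> cos (\<theta> - \<phi>)"
      by simp
    then have "r * s * cos \<zeta> \<le> r * s * cos (\<theta> - \<phi>)"
      using x y by (intro mult_left_mono) auto
    also have "\<dots> = inner x y"
      by (simp add: x y inner_complex_def cos_diff algebra_simps)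
    finally show "cos \<zeta> * cmod x * cmod y \<le> inner x y"
      using x y by (simp add: norm_mult mult_ac)
  qed
  moreover have "closed {p :: complex \<times> complex.
      cos \<zeta> * norm (fst p) * norm (snd p) \<le> inner (fst p) (snd p)}"
    by (intro closed_Collect_le continuous_intros)
  ultimately have "closure (F \<times> F) \<subseteq>
      {p. cos \<zeta> * norm (fst p) * norm (snd p) \<le> inner (fst p) (snd p)}"
    by (rule closure_minimal)
  then have "cos \<zeta> * norm z * norm w \<le> inner z w"
    using zw by (auto simp: closure_Times)
  moreover have "cos \<zeta> > 0"
    using assms(2,3) by (intro cos_gt_zero_pi) auto
  moreover have "z \<noteq> 0" "w \<noteq> 0"
    using nz zw by auto
  ultimately show ?thesis
    by (smt (verit) mult_pos_pos zero_less_norm_iff)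
qed

text \<open>The open quadrant around the positive imaginary axis, cut off at height \<rho> so that
  it avoids \<open>cball 0 \<rho>\<close>. The opening of a right angle makes inner products with
  the opposite quadrant negative.\<close>

definition upper_region :: "real \<Rightarrow> complex set" where
  "upper_region \<rho> = {z. \<bar>Re z\<bar> < Im z \<and> \<rho> < Im z}"

definition lower_region :: "real \<Rightarrow> complex set" where
  "lower_region \<rho> = {z. \<bar>Re z\<bar> < - Im z \<and> \<rho> < - Im z}"

lemma regions_open: "open (upper_region \<rho>)" "open (lower_region \<rho>)"
  unfolding upper_region_def lower_region_def
  by (intro open_Collect_conj open_Collect_less continuous_intros)+

lemma regions_convex: "convex (upper_region \<rho>)" "convex (lower_region \<rho>)"
proof -
  have "upper_region \<rho> = {z. inner (Complex 1 (-1)) z < 0} \<inter> {z. inner (Complex (-1) (-1)) z < 0}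
      \<inter> {z. inner (Complex 0 (-1)) z < - \<rho>}"
    by (auto simp: upper_region_def inner_complex_def abs_less_iff)
  then show "convex (upper_region \<rho>)"
    by (simp add: convex_Int convex_halfspace_lt)
  have "lower_region \<rho> = {z. inner (Complex 1 1) z < 0} \<inter> {z. inner (Complex (-1) 1) z < 0}
      \<inter> {z. inner (Complex 0 1) z < - \<rho>}"
    by (auto simp: lower_region_def inner_complex_def abs_less_iff)
  then show "convex (lower_region \<rho>)"
    by (simp add: convex_Int convex_halfspace_lt)
qed

lemma regions_disjoint: "0 \<le> \<rho> \<Longrightarrow> upper_region \<rho> \<inter> lower_region \<rho> = {}"
  by (auto simp: upper_region_def lower_region_def)

lemma inner_regions_neg:
  assumes "z \<in> upper_region \<rho>" "w \<in> lower_region \<rho>"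
  shows "inner z w < 0"
proof -
  have "\<bar>Re z\<bar> * \<bar>Re w\<bar> < Im z * (- Im w)"
    using assms by (intro mult_strict_mono') (auto simp: upper_region_def lower_region_def)
  moreover have "Re z * Re w \<le> \<bar>Re z\<bar> * \<bar>Re w\<bar>"
    by (metis abs_ge_self abs_mult)
  ultimately show ?thesis
    by (simp add: inner_complex_def)
qed

lemma outside_regions_wide:
  assumes "z \<notin> upper_region \<rho>" "z \<notin> lower_region \<rho>" "\<rho> < \<bar>Re z\<bar>"
  shows "\<bar>Im z\<bar> \<le> \<bar>Re z\<bar>"
  using assms by (auto simp: upper_region_def lower_region_def)

lemma outside_regions_bounded:
  assumes "z \<notin> upper_region \<rho>" "z \<notin> lower_region \<rho>" "\<bar>Re z\<bar> \<le> t" "\<rho> \<le> t"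
  shows "\<bar>Im z\<bar> \<le> t"
  using assms by (auto simp: upper_region_def lower_region_def)

lemma inner_nonpos_if_opposite:
  assumes "\<bar>Im z\<bar> \<le> \<bar>Re z\<bar>" "\<bar>Im w\<bar> \<le> \<bar>Re w\<bar>" "0 \<le> Re z" "Re w \<le> 0"
  shows "inner z w \<le> 0"
proof -
  have "\<bar>Im z\<bar> * \<bar>Im w\<bar> \<le> Re z * (- Re w)"
    using assms by (intro mult_mono) auto
  moreover have "Im z * Im w \<le> \<bar>Im z\<bar> * \<bar>Im w\<bar>"
    by (metis abs_ge_self abs_mult)
  ultimately show ?thesis
    by (simp add: inner_complex_def)
qed

lemma connected_set_joins_regions:
  assumes "connected H" "H \<inter> upper_region \<rho> \<noteq> {}" "H \<inter> lower_region \<rho> \<noteq> {}"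
  shows "connected (upper_region \<rho> \<union> H \<union> lower_region \<rho>)"
  using assms regions_convex[THEN convex_connected] by (intro connected_Un) auto

section \<open>Separation of the plane and construction of the double rays\<close>

context discrete_plane_graph
begin

lemma separating_component:
  assumes \<rho>: "0 \<le> \<rho>"
    and far: "\<And>F z w. F \<in> faces G \<Longrightarrow> \<not> closure F \<subseteq> cball 0 \<rho> \<Longrightarrow> z \<in> closure F \<Longrightarrow> w \<in> closure F
      \<Longrightarrow> inner z w > 0"
  obtains C where "closed C" "connected C" "C \<subseteq> skeleton"
    "C \<inter> upper_region \<rho> = {}" "C \<inter> lower_region \<rho> = {}"
    "\<And>t. \<exists>z\<in>C. t < Re z" "\<And>t. \<exists>z\<in>C. Re z < t"
proof -
  let ?P = "upper_region \<rho>" and ?Q = "lower_region \<rho>"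
  define Z where "Z = skeleton - (?P \<union> ?Q)"
  define p q where "p = Complex 0 (\<rho> + 1)" and "q = Complex 0 (- \<rho> - 1)"
  have pq: "p \<in> ?P" "q \<in> ?Q"
    using \<rho> by (auto simp: p_def q_def upper_region_def lower_region_def)
  have "closed Z"
    unfolding Z_def by (intro closed_Diff closed_skeleton open_Un regions_open)
  \<comment> \<open>Every face is assigned to one side; those that meet neither region go to
    \<open>W\<close> by convention.\<close>
  define U where "U = ?P \<union> \<Union>{F \<in> faces G. F \<inter> ?P \<noteq> {}}"
  define W where "W = ?Q \<union> \<Union>{F \<in> faces G. F \<inter> ?P = {}}"
  have one_region: "F \<inter> ?Q = {}" if F: "F \<in> faces G" "F \<inter> ?P \<noteq> {}" for F
  proof (rule ccontr)
    assume "F \<inter> ?Q \<noteq> {}"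
    then obtain z w where zw: "z \<in> F" "z \<in> ?P" "w \<in> F" "w \<in> ?Q"
      using F by blast
    have "z \<notin> cball 0 \<rho>"
      using zw(2) abs_Im_le_cmod[of z] by (auto simp: upper_region_def)
    then have "inner z w > 0"
      using far[OF F(1), of z w] zw closure_subset[of F] by blast
    then show False
      using inner_regions_neg[OF zw(2,4)] by simp
  qed
  have "\<not> connected_component (- Z) p q"
  proof
    assume "connected_component (- Z) p q"
    then obtain D where D: "connected D" "D \<subseteq> - Z" "p \<in> D" "q \<in> D"
      by (auto simp: connected_component_def)
    have "open U" "open W"
      unfolding U_def W_def using regions_open face_open by (auto intro!: open_Un open_Union)
    moreover have "D \<subseteq> U \<union> W"
    proof
      fix x
      assume "x \<in> D"
      then have "x \<in> ?P \<union> ?Q \<or> x \<in> - skeleton"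
        using D(2) by (auto simp: Z_def)
      moreover have "- skeleton = \<Union>(faces G)"
        by (simp add: faces_eq)
      ultimately show "x \<in> U \<union> W"
        unfolding U_def W_def by blast
    qed
    moreover have "U \<inter> W = {}"
    proof -
      have "F \<inter> F' = {}" if "F \<in> faces G" "F' \<in> faces G" "F \<inter> ?P \<noteq> {}" "F' \<inter> ?P = {}" for F F'
        using that components_nonoverlap[of F "- skeleton" F'] by (auto simp: faces_eq)
      then show ?thesis
        using one_region regions_disjoint[OF \<rho>] unfolding U_def W_def by blast
    qed
    moreover have "p \<in> U" "q \<in> W"
      using pq by (auto simp: U_def W_def)
    ultimately show False
      using D connectedD[of D U W] by blast
  qed
  then obtain C where C: "C \<in> components Z" "\<not> connected_component (- C) p q"
    using separation_by_component_closed_pointwise[OF \<open>closed Z\<close>] by blast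
  have CZ: "C \<subseteq> Z"
    using C(1) by (rule in_components_subset)
  \<comment> \<open>A connected set touching both regions and missing \<open>C\<close> would join
    \<open>p\<close> to \<open>q\<close> off \<open>C\<close>. Vertical half-planes then show that
    \<open>C\<close> extends arbitrarily far in both directions.\<close>
  have reach: "\<exists>z\<in>C. z \<in> H" if "connected H" "H \<inter> ?P \<noteq> {}" "H \<inter> ?Q \<noteq> {}" for H
  proof (rule ccontr)
    assume "\<not> (\<exists>z\<in>C. z \<in> H)"
    then have "?P \<union> H \<union> ?Q \<subseteq> - C"
      using CZ by (auto simp: Z_def)
    then have "connected_component (- C) p q"
      using connected_set_joins_regions[OF that] pq unfolding connected_component_def by blast
    then show False
      using C(2) by simp
  qed
  have "\<exists>z\<in>C. t < Re z" for t
  proof -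
    define s where "s = max \<rho> \<bar>t\<bar>"
    have "\<exists>z\<in>C. z \<in> {z. t < Re z}"
    proof (rule reach)
      show "connected {z. t < Re z}"
        by (intro convex_connected convex_halfspace_Re_gt)
      have "Complex (s + 1) (s + 2) \<in> {z. t < Re z} \<inter> ?P"
        "Complex (s + 1) (- s - 2) \<in> {z. t < Re z} \<inter> ?Q"
        by (auto simp: s_def upper_region_def lower_region_def)
      then show "{z. t < Re z} \<inter> ?P \<noteq> {}" "{z. t < Re z} \<inter> ?Q \<noteq> {}"
        by blast+
    qed
    then show ?thesis by simp
  qed
  moreover have "\<exists>z\<in>C. Re z < t" for t
  proof -
    define s where "s = max \<rho> \<bar>t\<bar>"
    have "\<exists>z\<in>C. z \<in> {z. Re z < t}"
    proof (rule reach)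
      show "connected {z. Re z < t}"
        by (intro convex_connected convex_halfspace_Re_lt)
      have "Complex (- s - 1) (s + 2) \<in> {z. Re z < t} \<inter> ?P"
        "Complex (- s - 1) (- s - 2) \<in> {z. Re z < t} \<inter> ?Q"
        by (auto simp: s_def upper_region_def lower_region_def)
      then show "{z. Re z < t} \<inter> ?P \<noteq> {}" "{z. Re z < t} \<inter> ?Q \<noteq> {}"
        by blast+
    qed
    then show ?thesis by simp
  qed
  moreover have "closed C" "connected C"
    using closed_components[OF \<open>closed Z\<close> C(1)] in_components_connected[OF C(1)] by auto
  moreover have "C \<subseteq> skeleton" "C \<inter> ?P = {}" "C \<inter> ?Q = {}"
    using CZ by (auto simp: Z_def)
  ultimately show ?thesis
    using that by blast
qed

text \<open>Far out there is an edge that meets \<open>C \<inter> H\<close> but not \<open>S\<close>. If its part in \<open>C \<inter> H\<close> contained no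
  vertex, that part would be open and closed in \<open>C\<close>.\<close>

lemma vertex_beyond:
  assumes C: "closed C" "connected C" "C \<subseteq> skeleton"
    and S: "compact S" and H: "closed H" "closed H'" "C \<inter> H \<inter> H' \<subseteq> S" "C \<subseteq> H \<union> H'"
    and HC: "\<not> bounded (C \<inter> H)" and H'C: "\<not> C \<subseteq> H"
  obtains v where "v \<in> C \<inter> verts G" "v \<in> H"
proof -
  define E where "E = {e \<in> edges G. arc_of e \<inter> S \<noteq> {}}"
  have "finite E"
    unfolding E_def using finite_edges_meeting_compact[OF S] .
  then have "bounded (\<Union>e\<in>E. arc_of e)"
    using edge_arc by (auto simp: E_def bounded_arc_image)
  then obtain x where x: "x \<in> C \<inter> H" "x \<notin> (\<Union>e\<in>E. arc_of e)"
    using HC by (meson bounded_subset subsetI)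
  then obtain e where e: "e \<in> edges G" "x \<in> arc_of e" "arc_of e \<inter> S = {}"
    using C(3) unfolding E_def skeleton_def by blast
  define D where "D = C \<inter> arc_of e \<inter> H"
  \<comment> \<open>The rest of the skeleton as far as \<open>C\<close> is concerned: other edges
    could meet \<open>D\<close> only in vertices, and the part of \<open>e\<close> in
    \<open>H'\<close> could meet it only in \<open>S\<close>, which \<open>e\<close> avoids.\<close>
  define D' where "D' = (\<Union>f\<in>edges G - {e}. arc_of f) \<union> (arc_of e \<inter> H')"
  have "\<exists>v. v \<in> D \<inter> verts G"
  proof (rule ccontr)
    assume none: "\<nexists>v. v \<in> D \<inter> verts G"
    have "closed D" "closed D'"
      unfolding D_def D'_def using C(1) H(1,2) e(1) closed_arc_of
      by (auto intro!: closed_Int closed_Un closed_Union_edge_parts)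
    moreover have "D \<inter> D' \<inter> C = {}"
    proof -
      have "D \<inter> arc_of f = {}" if "f \<in> edges G - {e}" for f
        using arcs_meet[of e f] that e(1) none by (auto simp: D_def)
      then show ?thesis
        using H(3) e(3) by (auto simp: D_def D'_def)
    qed
    moreover have "C \<subseteq> D \<union> D'"
      using C(3) H(4) unfolding D_def D'_def skeleton_def by blast
    ultimately have "D \<inter> C = {} \<or> D' \<inter> C = {}"
      using C(2) connected_closedD[of C D D'] by blast
    moreover have "x \<in> D"
      using x e by (auto simp: D_def)
    moreover have "D' \<inter> C \<noteq> {}"
      using H'C \<open>C \<subseteq> D \<union> D'\<close> by (auto simp: D_def)
    ultimately show False
      using x by blast
  qed
  then show ?thesis
    using that by (auto simp: D_def)
qed

text \<open>The relation \<open>E\<close> lies between the two adjacencies so that one proof serves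
  both graphs. The upper bound gives finite degrees and excludes edges from left to right; the lower
  bound gives connectivity.\<close>

lemma induced_double_rays:
  assumes \<rho>: "0 \<le> \<rho>"
    and far: "\<And>F z w. F \<in> faces G \<Longrightarrow> \<not> closure F \<subseteq> cball 0 \<rho> \<Longrightarrow> z \<in> closure F \<Longrightarrow> w \<in> closure F
      \<Longrightarrow> inner z w > 0"
    and E_sub: "\<And>u v. E u v \<Longrightarrow> adj (matching_graph G) u v" and E_sup: "\<And>u v. adj G u v \<Longrightarrow> E u v"
    and E_sym: "\<And>u v. E u v \<Longrightarrow> E v u"
  shows "\<exists>\<pi>::int \<Rightarrow> complex. range \<pi> \<subseteq> verts G \<and> (\<forall>i j. E (\<pi> i) (\<pi> j) \<longleftrightarrow> \<bar>i - j\<bar> = 1)"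
proof -
  obtain C where C: "closed C" "connected C" "C \<subseteq> skeleton"
    and reg: "C \<inter> upper_region \<rho> = {}" "C \<inter> lower_region \<rho> = {}"
    and right: "\<And>t. \<exists>z\<in>C. t < Re z" and left: "\<And>t. \<exists>z\<in>C. Re z < t"
  proof (rule separating_component[OF \<rho>])
    show "inner z w > 0"
      if "F \<in> faces G" "\<not> closure F \<subseteq> cball 0 \<rho>" "z \<in> closure F" "w \<in> closure F" for F z w
      using far that .
  qed (rule that)
  define V where "V = C \<inter> verts G"
  define A where "A = {v \<in> V. \<rho> < Re v}"
  define B where "B = {v \<in> V. Re v < - \<rho>}"
  define box where "box t = cbox (Complex (-t) (-t)) (Complex t t)" for t
  have in_box: "z \<in> box t" if "z \<in> C" "\<bar>Re z\<bar> \<le> t" "\<rho> \<le> t" for z t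
  proof -
    have "\<bar>Im z\<bar> \<le> t"
      using outside_regions_bounded[of z \<rho> t] that reg by blast
    then show ?thesis
      using that(2) by (auto simp: box_def in_cbox_complex_iff abs_le_iff)
  qed
  have unb_right: "\<not> bounded (C \<inter> {z. t \<le> Re z})" for t
  proof
    assume "bounded (C \<inter> {z. t \<le> Re z})"
    then obtain b where b: "\<And>z. z \<in> C \<Longrightarrow> t \<le> Re z \<Longrightarrow> norm z \<le> b"
      by (auto simp: bounded_iff)
    obtain z where "z \<in> C" "max t b < Re z"
      using right by blast
    then show False
      using b[of z] complex_Re_le_cmod[of z] by auto
  qed
  have unb_left: "\<not> bounded (C \<inter> {z. Re z \<le> t})" for t
  proof
    assume "bounded (C \<inter> {z. Re z \<le> t})"
    then obtain b where b: "\<And>z. z \<in> C \<Longrightarrow> Re z \<le> t \<Longrightarrow> norm z \<le> b"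
      by (auto simp: bounded_iff)
    obtain z where "z \<in> C" "Re z < min t (- b)"
      using left by blast
    then show False
      using b[of z] abs_Re_le_cmod[of z] by auto
  qed
  have "\<exists>v\<in>A. t < Re v" for t
  proof -
    \<comment> \<open>Since \<open>s\<close> exceeds \<rho>, the line with real part
      \<open>s\<close> meets \<open>C\<close> only within the compact box, as
      \<open>vertex_beyond\<close> demands.\<close>
    define s where "s = max \<rho> \<bar>t\<bar> + 1"
    have s: "\<rho> < s" "t < s" "0 \<le> s"
      using \<rho> by (auto simp: s_def)
    obtain v where "v \<in> C \<inter> verts G" "v \<in> {z. s \<le> Re z}"
    proof (rule vertex_beyond[OF C, of "box s" "{z. s \<le> Re z}" "{z. Re z \<le> s}"])
      show "\<not> C \<subseteq> {z. s \<le> Re z}"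
        using left[of s] by force
      show "C \<inter> {z. s \<le> Re z} \<inter> {z. Re z \<le> s} \<subseteq> box s"
        using in_box[of _ s] s by auto
    qed (use unb_right in \<open>auto simp: box_def closed_halfspace_Re_ge closed_halfspace_Re_le\<close>)
    then show ?thesis
      using s by (intro bexI[of _ v]) (auto simp: A_def V_def)
  qed
  then have infA: "infinite A"
    using finite_imageI[of A Re] by (metis Max_ge finite_imageI imageI leD)
  have "\<exists>v\<in>B. Re v < t" for t
  proof -
    define s where "s = max \<rho> \<bar>t\<bar> + 1"
    have s: "\<rho> < s" "- s < t" "0 \<le> s"
      using \<rho> by (auto simp: s_def)
    obtain v where "v \<in> C \<inter> verts G" "v \<in> {z. Re z \<le> - s}"
    proof (rule vertex_beyond[OF C, of "box s" "{z. Re z \<le> - s}" "{z. Re z \<ge> - s}"])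
      show "\<not> C \<subseteq> {z. Re z \<le> - s}"
        using right[of "- s"] by force
      show "C \<inter> {z. Re z \<le> - s} \<inter> {z. Re z \<ge> - s} \<subseteq> box s"
        using in_box[of _ s] s by auto
    qed (use unb_left in \<open>auto simp: box_def closed_halfspace_Re_ge closed_halfspace_Re_le\<close>)
    then show ?thesis
      using s by (intro bexI[of _ v]) (auto simp: B_def V_def)
  qed
  then have infB: "infinite B"
    using finite_imageI[of B Re] by (metis Min_le finite_imageI imageI leD)
  have "\<exists>\<pi>::int \<Rightarrow> complex. range \<pi> \<subseteq> V \<and> (\<forall>i j. E (\<pi> i) (\<pi> j) \<longleftrightarrow> \<bar>i - j\<bar> = 1)"
  proof (rule induced_double_ray_exists)
    show "\<not> E u u" for u
      using E_sub matching_adj_irrefl by blast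
    show "finite {v \<in> V. E u v}" if "u \<in> V" for u
      by (rule finite_subset[OF _ matching_locally_finite[of u]])
        (use that E_sub in \<open>auto simp: V_def\<close>)
    show "(\<lambda>x y. E x y \<and> x \<in> V \<and> y \<in> V)\<^sup>*\<^sup>* u v" if "u \<in> V" "v \<in> V" for u v
      by (rule rtranclp_mono[THEN predicate2D,
            OF _ connected_subset_skeleton_vertices_joined[OF C(2,3)]])
        (use that E_sup in \<open>auto simp: V_def\<close>)
    show "finite (V - (A \<union> B))"
    proof (rule finite_subset)
      show "V - (A \<union> B) \<subseteq> box \<rho> \<inter> verts G"
      proof
        fix v
        assume "v \<in> V - (A \<union> B)"
        then have "v \<in> C" "v \<in> verts G" "\<bar>Re v\<bar> \<le> \<rho>"
          by (auto simp: V_def A_def B_def)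
        then show "v \<in> box \<rho> \<inter> verts G"
          using in_box[of v \<rho>] by simp
      qed
      show "finite (box \<rho> \<inter> verts G)"
        by (rule finite_verts_compact) (simp add: box_def)
    qed
    show "A \<inter> B = {}"
      using \<rho> by (auto simp: A_def B_def)
    \<comment> \<open>A common face would have a closure reaching outside the disc, forcing a
      positive inner product. But \<open>a\<close> and \<open>b\<close> avoid both regions, so they
      lie in the opposite right and left quadrants.\<close>
    show "\<not> E a b" if "a \<in> A" "b \<in> B" for a b
    proof
      assume "E a b"
      then obtain F e where F: "F \<in> faces G" "e \<in> edges G" "a \<in> e" "arc_of e \<subseteq> closure F"
        "b \<in> closure F"
        using matching_adjD[OF E_sub] by metis
      then have aF: "a \<in> closure F"
        using edge_subset_arc by blast
      have Re: "\<rho> < Re a" "Re b < - \<rho>" "a \<in> C" "b \<in> C"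
        using that by (auto simp: A_def B_def V_def)
      then have "a \<notin> cball 0 \<rho>"
        using complex_Re_le_cmod[of a] by auto
      then have "inner a b > 0"
        using far[OF F(1)] aF F(5) by blast
      moreover have "inner a b \<le> 0"
        using Re \<rho> reg outside_regions_wide[of a \<rho>] outside_regions_wide[of b \<rho>]
        by (intro inner_nonpos_if_opposite) auto
      ultimately show False
        by simp
    qed
  qed (use infA infB E_sym in \<open>auto simp: A_def B_def\<close>)
  then show ?thesis
    unfolding V_def by blast
qed

end

section \<open>From adjacency patterns to paths\<close>

lemma double_ray_pathI:
  assumes "range \<pi> \<subseteq> verts H" "\<And>i j. adj H (\<pi> i) (\<pi> j) \<longleftrightarrow> \<bar>i - j\<bar> = 1"
  shows "doubly_infinite_path H \<pi> \<and> non_self_touching H \<pi>"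
  using assms inj_if_adjacent_iff_consecutive[of "adj H" \<pi>]
  by (auto simp: doubly_infinite_path_def non_self_touching_def)

theorem theorem4p2:
  fixes G :: plane_drawing
  assumes "G \<in> class_G"
    and "\<exists>\<zeta>::real. 0 < \<zeta> \<and> \<zeta> < pi / 2 \<and> finite {F \<in> faces G. \<not> acute \<zeta> F}"
  shows "(\<exists>\<pi>. doubly_infinite_path G \<pi> \<and> non_self_touching G \<pi>) \<and>
         (\<exists>\<pi>. doubly_infinite_path (matching_graph G) \<pi> \<and>
              non_self_touching (matching_graph G) \<pi>)"
proof -
  interpret discrete_plane_graph G
    by unfold_locales (rule assms(1))
  obtain \<zeta> :: real where \<zeta>: "0 < \<zeta>" "\<zeta> < pi / 2" "finite {F \<in> faces G. \<not> acute \<zeta> F}"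
    using assms(2) by blast
  have "bounded (\<Union>F\<in>{F \<in> faces G. \<not> acute \<zeta> F}. closure F)"
    using \<zeta>(3) face_bounded by (intro bounded_UN) auto
  \<comment> \<open>The disc swallows the finitely many bounded faces that are not acute, so any
    face whose closure is not inside it is acute.\<close>
  then obtain \<rho> where \<rho>: "0 \<le> \<rho>" "(\<Union>F\<in>{F \<in> faces G. \<not> acute \<zeta> F}. closure F) \<subseteq> cball 0 \<rho>"
    unfolding bounded_pos by (auto simp: subset_iff intro: less_imp_le)
  have far: "inner z w > 0"
    if "F \<in> faces G" "\<not> closure F \<subseteq> cball 0 \<rho>" "z \<in> closure F" "w \<in> closure F" for F z w
    using acute_imp_inner_pos[of \<zeta> F z w] that \<zeta> \<rho>(2) by blast
  have "\<exists>\<pi>::int \<Rightarrow> complex. range \<pi> \<subseteq> verts G \<and> (\<forall>i j. adj G (\<pi> i) (\<pi> j) \<longleftrightarrow> \<bar>i - j\<bar> = 1)"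
    by (rule induced_double_rays[OF \<rho>(1) far])
      (auto intro: adj_imp_matching_adj adj_sym)
  moreover have "\<exists>\<pi>::int \<Rightarrow> complex. range \<pi> \<subseteq> verts G \<and>
      (\<forall>i j. adj (matching_graph G) (\<pi> i) (\<pi> j) \<longleftrightarrow> \<bar>i - j\<bar> = 1)"
    by (rule induced_double_rays[OF \<rho>(1) far])
      (auto intro: adj_imp_matching_adj adj_sym)
  moreover have "verts (matching_graph G) = verts G"
    by (simp add: matching_graph_def)
  ultimately show ?thesis
    using double_ray_pathI by metis
qed

end
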